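(* Let $\alpha,\beta,\gamma,p,x,y\in\mathbb{C}$ with $\mathrm{Re}(\alpha)>0$, $\mathrm{Re}(p)>0$, $\mathrm{Re}(x)>0$, $\mathrm{Re}(y)>0$. Then $${}^{ML}B_{p}(x,y)=\sum_{n=0}^{\infty}{}^{ML}B_{p}(x+n,y+1).$$
   Context: The three-parameter Mittag-Leffler function is $E_{\alpha,\beta}^{\gamma}(z)=\sum_{n=0}^{\infty}\frac{(\gamma)_n}{\Gamma(\alpha n+\beta)}\frac{z^n}{n!}$ for $\alpha,\beta,\gamma\in\mathbb{C}$, $\mathrm{Re}(\alpha)>0$, where $(\gamma)_n=\gamma(\gamma+1)\cdots(\gamma+n-1)$, $(\gamma)_0=1$. The ML-generalized beta function is ${}^{ML}B_{p}(x,y)=\int_{0}^{1}t^{x-1}(1-t)^{y-1}E_{\alpha,\beta}^{\gamma}\left(-\frac{p}{t(1-t)}\right)dt$ for $\mathrm{Re}(p)>0$, $\mathrm{Re}(x)>0$, $\mathrm{Re}(y)>0$, $\mathrm{Re}(\alpha)>0$ (the parameters $\alpha,\beta,\gamma$ are suppressed in the notation).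
   Formalization: The integral defining the left-hand side is additionally assumed to converge (possibly conditionally), since it can diverge under the stated conditions, e.g. for γ = -1, α = β = p = 1, x = 1/2, y = 2. *)

theory Defs
  imports "HOL-Analysis.Analysis"
begin

text \<open>
  \<^const>\<open>rGamma\<close> is the entire function \<open>1/\<Gamma>\<close>, which vanishes at the poles of \<open>\<Gamma>\<close>; hence
  no restriction on \<open>\<beta>\<close> is needed.
\<close>

definition mittag_leffler3 :: "complex \<Rightarrow> complex \<Rightarrow> complex \<Rightarrow> complex \<Rightarrow> complex" where
  "mittag_leffler3 \<alpha> \<beta> \<gamma> z =
     (\<Sum>n. pochhammer \<gamma> n * rGamma (\<alpha> * of_nat n + \<beta>) * (z ^ n / fact n))"

definition mlbeta_integrand ::
  "complex \<Rightarrow> complex \<Rightarrow> complex \<Rightarrow> complex \<Rightarrow> complex \<Rightarrow> complex \<Rightarrow> real \<Rightarrow> complex" where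
  "mlbeta_integrand \<alpha> \<beta> \<gamma> p x y t =
     of_real t powr (x - 1) * of_real (1 - t) powr (y - 1) *
     mittag_leffler3 \<alpha> \<beta> \<gamma> (- p / of_real (t * (1 - t)))"

text \<open>
  The integral is the Henstock--Kurzweil integral, which agrees with the Lebesgue integral and with
  the (possibly only conditionally convergent) improper Riemann integral whenever one of these
  exists. It need not exist for all parameters with positive real parts: for \<open>\<gamma> = -1\<close> and
  \<open>\<alpha> = \<beta> = p = 1\<close> the Mittag-Leffler factor is \<open>1 + 1 / (t * (1 - t))\<close>, and the integral
  diverges unless \<open>Re x > 1\<close> and \<open>Re y > 1\<close>. Where it diverges, \<open>mlbeta\<close> has the
  meaningless default value \<open>0\<close>, so \<open>mlbeta_exists\<close> expresses that the value is genuine.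
\<close>

definition mlbeta_exists ::
  "complex \<Rightarrow> complex \<Rightarrow> complex \<Rightarrow> complex \<Rightarrow> complex \<Rightarrow> complex \<Rightarrow> bool" where
  "mlbeta_exists \<alpha> \<beta> \<gamma> p x y \<longleftrightarrow> mlbeta_integrand \<alpha> \<beta> \<gamma> p x y integrable_on {0..1}"

definition mlbeta ::
  "complex \<Rightarrow> complex \<Rightarrow> complex \<Rightarrow> complex \<Rightarrow> complex \<Rightarrow> complex \<Rightarrow> complex" where
  "mlbeta \<alpha> \<beta> \<gamma> p x y = integral {0..1} (mlbeta_integrand \<alpha> \<beta> \<gamma> p x y)"

end

theory Submission
  imports Defs
begin

text \<open>
  Since \<open>t\<^sup>n (1 - t) = t\<^sup>n - t\<^sup>n\<^sup>+\<^sup>1\<close>, the series telescopes: its partial sums differ from the integral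
  of the integrand \<open>f\<close> for \<open>(x, y)\<close> by the moments \<open>\<integral> t\<^sup>n f(t) dt\<close>. As \<open>f\<close> may be only conditionally
  integrable, dominated convergence is unavailable; that the moments exist and tend to zero follows
  instead from the second mean value theorem for the monotone weight \<open>t\<^sup>n\<close>.
\<close>

lemma integrable_power_mult:
  fixes f :: "real \<Rightarrow> real"
  assumes "f integrable_on {a..b}" and "0 \<le> a"
  shows "(\<lambda>t. t ^ n * f t) integrable_on {a..b}"
proof (cases "a \<le> b")
  case True
  have "\<And>s t. \<lbrakk>a \<le> s; s \<le> t; t \<le> b\<rbrakk> \<Longrightarrow> s ^ n \<le> t ^ n"
    using assms(2) by (intro power_mono) auto
  then show ?thesis
    using second_mean_value_theorem_full[OF assms(1) True, of "\<lambda>t. t ^ n"]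
    by (metis has_integral_integrable)
qed auto

text \<open>Split at a fixed \<open>d\<close> close to 1. On \<open>{0..d}\<close> the weight is at
  most \<open>d ^ n\<close>, which decays; \<open>{d..1}\<close> contributes, up to a multiple of
  \<open>d ^ n\<close>, only an integral of \<open>f\<close> over some \<open>{c2..1}\<close>, small
  by continuity of \<open>G\<close>.\<close>

lemma power_moments_tendsto_0_real:
  fixes f :: "real \<Rightarrow> real"
  assumes f: "f integrable_on {0..1}"
  shows "(\<lambda>n. integral {0..1} (\<lambda>t. t ^ n * f t)) \<longlonglongrightarrow> 0"
proof (rule LIMSEQ_I)
  fix e :: real
  assume "e > 0"
  define G where "G c = integral {c..1} f" for c
  have cont: "continuous_on {0..1} G"
    unfolding G_def by (rule indefinite_integral_continuous_1'[OF f])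
  have G_diff: "integral {c..d} f = G c - G d" if "0 \<le> c" "c \<le> d" "d \<le> 1" for c d
    using Henstock_Kurzweil_Integration.integral_combine[of c d 1 f] integrable_subinterval_real[OF f, of c 1] that
    by (simp add: G_def)
  have "bounded (G ` {0..1})"
    by (intro compact_imp_bounded compact_continuous_image cont compact_Icc)
  \<comment> \<open>The points \<open>c1\<close> and \<open>c2\<close> below vary with
    \<open>n\<close>, hence a bound uniform in \<open>c\<close>.\<close>
  then obtain B where B: "\<And>c. c \<in> {0..1} \<Longrightarrow> \<bar>G c\<bar> \<le> B"
    unfolding bounded_iff by (metis imageI real_norm_def)
  obtain r where "r > 0" and r: "\<And>c. \<lbrakk>c \<in> {0..1}; dist c 1 < r\<rbrakk> \<Longrightarrow> dist (G c) (G 1) < e / 2"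
    using cont \<open>e > 0\<close> unfolding continuous_on_iff by (metis atLeastAtMost_iff half_gt_zero order_refl zero_le_one)
  \<comment> \<open>\<open>1 - r / 2\<close> puts \<open>{d..1}\<close> within distance
    \<open>r\<close> of 1; \<open>1 / 2\<close> keeps \<open>d\<close> positive when
    \<open>r\<close> is large.\<close>
  define d where "d = max (1 / 2) (1 - r / 2)"
  have d: "0 < d" "d < 1" "1 - d < r"
    using \<open>r > 0\<close> by (auto simp: d_def)
  \<comment> \<open>Here \<open>G 1 = 0\<close>, so closeness to \<open>G 1\<close> is
    smallness.\<close>
  have small: "\<bar>G c\<bar> < e / 2" if "d \<le> c" "c \<le> 1" for c
    using r[of c] d that by (simp add: G_def dist_real_def)
  \<comment> \<open>For \<open>n > 0\<close> the endpoint weight \<open>0 ^ n\<close> in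
    \<open>I1\<close> vanishes; this is why the final index is \<open>Suc N\<close>.\<close>
  have bound: "\<bar>integral {0..1} (\<lambda>t. t ^ n * f t)\<bar> < d ^ n * (2 * B) + e / 2" if "n > 0" for n
  proof -
    have mono: "\<And>s t. \<lbrakk>0 \<le> s; s \<le> t\<rbrakk> \<Longrightarrow> s ^ n \<le> (t::real) ^ n"
      by (intro power_mono)
    obtain c1 where c1: "c1 \<in> {0..d}"
      and I1: "integral {0..d} (\<lambda>t. t ^ n * f t) = 0 ^ n * integral {0..c1} f + d ^ n * integral {c1..d} f"
      using second_mean_value_theorem[of f 0 d "\<lambda>t. t ^ n"] integrable_subinterval_real[OF f, of 0 d]
        d mono by auto
    obtain c2 where c2: "c2 \<in> {d..1}"
      and I2: "integral {d..1} (\<lambda>t. t ^ n * f t) = d ^ n * integral {d..c2} f + 1 ^ n * integral {c2..1} f"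
      using second_mean_value_theorem[of f d 1 "\<lambda>t. t ^ n"] integrable_subinterval_real[OF f, of d 1]
        d mono by auto
    have "integral {0..1} (\<lambda>t. t ^ n * f t)
        = integral {0..d} (\<lambda>t. t ^ n * f t) + integral {d..1} (\<lambda>t. t ^ n * f t)"
      using Henstock_Kurzweil_Integration.integral_combine[of 0 d 1 "\<lambda>t. t ^ n * f t"]
        integrable_power_mult[OF f] d by simp
    \<comment> \<open>The two occurrences of \<open>d ^ n * G d\<close> cancel.\<close>
    also have "\<dots> = d ^ n * (G c1 - G c2) + G c2"
    proof -
      have "integral {0..d} (\<lambda>t. t ^ n * f t) = d ^ n * (G c1 - G d)"
        using I1 G_diff[of c1 d] c1 d that by simp
      moreover have "integral {d..1} (\<lambda>t. t ^ n * f t) = d ^ n * (G d - G c2) + G c2"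
        using I2 G_diff[of d c2] c2 d by (simp add: G_def)
      ultimately show ?thesis
        by (simp add: algebra_simps)
    qed
    finally have eq: "integral {0..1} (\<lambda>t. t ^ n * f t) = d ^ n * (G c1 - G c2) + G c2" .
    have "\<bar>G c1 - G c2\<bar> \<le> 2 * B"
      using B[of c1] B[of c2] c1 c2 d by auto
    then have "\<bar>d ^ n * (G c1 - G c2)\<bar> \<le> d ^ n * (2 * B)"
      using d by (simp add: abs_mult)
    then show ?thesis
      using eq small[of c2] c2 by auto
  qed
  have "(\<lambda>n. d ^ n * (2 * B)) \<longlonglongrightarrow> 0 * (2 * B)"
    using d by (intro tendsto_intros LIMSEQ_realpow_zero) auto
  then have "\<forall>\<^sub>F n in sequentially. d ^ n * (2 * B) < e / 2"
    using \<open>e > 0\<close> by (intro order_tendstoD) auto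
  then obtain N where N: "\<And>n. n \<ge> N \<Longrightarrow> d ^ n * (2 * B) < e / 2"
    by (auto simp: eventually_sequentially)
  show "\<exists>N. \<forall>n\<ge>N. norm (integral {0..1} (\<lambda>t. t ^ n * f t) - 0) < e"
  proof (intro exI allI impI)
    fix n assume "n \<ge> Suc N"
    then show "norm (integral {0..1} (\<lambda>t. t ^ n * f t) - 0) < e"
      using bound[of n] N[of n] by simp
  qed
qed

text \<open>The second mean value theorem is real-valued, so complex integrands are handled by
  components.\<close>

lemma integrable_power_scaleR:
  fixes f :: "real \<Rightarrow> 'a::euclidean_space"
  assumes "f integrable_on {a..b}" and "0 \<le> a"
  shows "(\<lambda>t. t ^ n *\<^sub>R f t) integrable_on {a..b}"
  using assms integrable_power_mult
  by (subst integrable_componentwise_iff) (auto simp: integrable_componentwise_iff[of f])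

lemma power_moments_tendsto_0:
  fixes f :: "real \<Rightarrow> 'a::euclidean_space"
  assumes f: "f integrable_on {0..1}"
  shows "(\<lambda>n. integral {0..1} (\<lambda>t. t ^ n *\<^sub>R f t)) \<longlonglongrightarrow> 0"
proof (subst tendsto_componentwise_iff, intro ballI)
  fix b :: 'a
  assume "b \<in> Basis"
  then have "(\<lambda>t. f t \<bullet> b) integrable_on {0..1}"
    using f integrable_componentwise_iff by blast
  then show "(\<lambda>n. integral {0..1} (\<lambda>t. t ^ n *\<^sub>R f t) \<bullet> b) \<longlonglongrightarrow> 0 \<bullet> b"
    using power_moments_tendsto_0_real
    by (simp add: integral_component_eq[symmetric] integrable_power_scaleR[OF f])
qed

text \<open>At \<open>t = 0\<close> both sides vanish because \<open>0 powr z = 0\<close>, even for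
  \<open>n = 0\<close>. Validity for every real \<open>t\<close> makes the shift below an equality
  of functions, endpoints included.\<close>

lemma of_real_powr_add_of_nat:
  "complex_of_real t powr (z + of_nat n) = t ^ n *\<^sub>R complex_of_real t powr z"
  by (cases "t = 0") (simp_all add: powr_add powr_nat scaleR_conv_of_real)

lemma mlbeta_integrand_shift:
  "mlbeta_integrand \<alpha> \<beta> \<gamma> p (x + of_nat n) (y + 1) t =
     t ^ n *\<^sub>R mlbeta_integrand \<alpha> \<beta> \<gamma> p x y t - t ^ Suc n *\<^sub>R mlbeta_integrand \<alpha> \<beta> \<gamma> p x y t"
proof -
  have x: "complex_of_real t powr (x + of_nat n - 1) = t ^ n *\<^sub>R complex_of_real t powr (x - 1)"
    using of_real_powr_add_of_nat[of t "x - 1" n] by (simp add: algebra_simps)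
  have y: "complex_of_real (1 - t) powr (y + 1 - 1) = (1 - t) *\<^sub>R complex_of_real (1 - t) powr (y - 1)"
    using of_real_powr_add_of_nat[of "1 - t" "y - 1" 1] by simp
  show ?thesis
    unfolding mlbeta_integrand_def x y by (simp add: scaleR_conv_of_real algebra_simps)
qed

theorem theorem2p5:
  fixes \<alpha> \<beta> \<gamma> p x y :: complex
  assumes "Re \<alpha> > 0" and "Re p > 0" and "Re x > 0" and "Re y > 0"
    and "mlbeta_exists \<alpha> \<beta> \<gamma> p x y"
  shows "(\<forall>n. mlbeta_exists \<alpha> \<beta> \<gamma> p (x + of_nat n) (y + 1)) \<and>
         (\<lambda>n. mlbeta \<alpha> \<beta> \<gamma> p (x + of_nat n) (y + 1)) sums mlbeta \<alpha> \<beta> \<gamma> p x y"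
proof -
  define f where "f = mlbeta_integrand \<alpha> \<beta> \<gamma> p x y"
  define a where "a n = integral {0..1} (\<lambda>t. t ^ n *\<^sub>R f t)" for n
  have f: "f integrable_on {0..1}"
    using assms(5) by (simp add: f_def mlbeta_exists_def)
  have shift: "mlbeta_integrand \<alpha> \<beta> \<gamma> p (x + of_nat n) (y + 1) =
      (\<lambda>t. t ^ n *\<^sub>R f t - t ^ Suc n *\<^sub>R f t)" for n
    unfolding f_def by (rule ext) (rule mlbeta_integrand_shift)
  have int: "(\<lambda>t. t ^ n *\<^sub>R f t) integrable_on {0..1}" for n
    by (rule integrable_power_scaleR[OF f]) simp
  have ex: "mlbeta_exists \<alpha> \<beta> \<gamma> p (x + of_nat n) (y + 1)" for n
    unfolding mlbeta_exists_def shift by (intro integrable_diff int)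
  \<comment> \<open>Splitting the integral is sound because each moment exists separately, by
    \<open>int\<close>.\<close>
  have "mlbeta \<alpha> \<beta> \<gamma> p (x + of_nat n) (y + 1) = a n - a (Suc n)" for n
    unfolding mlbeta_def shift a_def by (intro integral_diff int)
  moreover have "(\<lambda>n. a n - a (Suc n)) sums (a 0 - 0)"
    unfolding a_def by (intro telescope_sums' power_moments_tendsto_0 f)
  \<comment> \<open>The weight \<open>t ^ 0\<close> is 1 also at \<open>t = 0\<close>.\<close>
  moreover have "a 0 = mlbeta \<alpha> \<beta> \<gamma> p x y"
    by (simp add: a_def f_def mlbeta_def)
  ultimately show ?thesis
    using ex by simp
qed

end
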